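(* Let $Y\subset V$ and $\Omega\subset\{1,2,\ldots,M\}$ be nonempty sets satisfying $$\alpha(Y,\Omega):=\Big(\sum_{m\in\Omega}\sum_{v\in Y}\big\|\widehat{\boldsymbol{\delta}_v}(m)\big\|_2^2\Big)^{1/2}<1.$$ Then, for all graph signals $\mathbf{x}=[x(v)]_{v\in V}$, $$\|\mathbf{x}\|_2\le(1-\alpha(Y,\Omega))^{-1}\Big(\sum_{m\notin\Omega}\|\widehat{\mathbf{x}}(m)\|_2^2\Big)^{1/2}+\frac{\big(\dim\Omega-(\alpha(Y,\Omega))^2\big)^{1/2}}{1-\alpha(Y,\Omega)}\Big(\sum_{v\notin Y}|x(v)|^2\Big)^{1/2},$$ where $\dim\Omega$ is the dimension of the direct sum $\bigoplus_{m\in\Omega}W_m$.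
   Context: Let $\mathcal{G}=(V,E,\mathbf{W})$ be a finite, simple, undirected graph with $N\ge 2$ vertices. A graph signal is a vector $\mathbf{x}=[x(v)]_{v\in V}\in\mathbb{R}^V$, with Euclidean norm $\|\mathbf{x}\|_2$. A graph shift is a matrix $\mathbf{S}=[s(i,j)]_{i,j\in V}$ with $s(i,j)=0$ unless $i=j$ or $(i,j)\in E$. Standing assumption: $\mathbf{S}_1,\ldots,\mathbf{S}_d$ are graph shifts that are real-valued, symmetric and pairwise commuting. Choose an orthogonal matrix $\mathbf{U}=[\mathbf{u}_1,\ldots,\mathbf{u}_N]$ with $\mathbf{S}_l=\sum_{n=1}^N\lambda_l(n)\mathbf{u}_n\mathbf{u}_n^T$ for $1\le l\le d$, and set $\boldsymbol{\lambda}(n)=[\lambda_1(n),\ldots,\lambda_d(n)]^T\in\mathbb{R}^d$. Let $\boldsymbol{\gamma}(m)=[\gamma_1(m),\ldots,\gamma_d(m)]^T$, $1\le m\le M$, be the distinct elements of $\{\boldsymbol{\lambda}(n): 1\le n\le N\}$. Put $\mathbf{P}_m=\sum_{\boldsymbol{\lambda}(n)=\boldsymbol{\gamma}(m)}\mathbf{u}_n\mathbf{u}_n^T$ (independent of the choice of $\mathbf{U}$), $W_m=\mathbf{P}_m\mathbb{R}^V=\bigcap_{l=1}^d\ker(\mathbf{S}_l-\gamma_l(m)\mathbf{I})$, and $\widehat{\mathbf{x}}(m)=\mathbf{P}_m\mathbf{x}$ for $\mathbf{x}\in\mathbb{R}^V$, $1\le m\le M$ (the graph Fourier transform). For $v\in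 V$, $\boldsymbol{\delta}_v\in\mathbb{R}^V$ is the delta signal at $v$, equal to $1$ at $v$ and $0$ at all other vertices. *)

theory Defs
  imports "HOL-Analysis.Analysis"
begin

text \<open>The vertex set is the finite type \<open>'v\<close>, a graph signal is a vector in \<open>real^'v\<close>, and the
  delta signal at \<open>v\<close> is the library's \<open>axis v 1\<close>. The edge relation contains both orientations
  of each edge. The edge weights impose no condition on the graph shifts and are not represented.\<close>

definition simple_graph :: "('v \<times> 'v) set \<Rightarrow> bool" where
  "simple_graph E \<longleftrightarrow> sym E \<and> irrefl E"

definition graph_shift :: "('v \<times> 'v) set \<Rightarrow> real^'v^'v \<Rightarrow> bool" where
  "graph_shift E S \<longleftrightarrow> (\<forall>i j. i \<noteq> j \<and> (i, j) \<notin> E \<longrightarrow> S $ i $ j = 0)"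

definition outer :: "real^'v \<Rightarrow> real^'v^'v" where
  "outer u = (\<chi> i j. u $ i * u $ j)"

text \<open>The pairs \<open>(U, \<lambda>)\<close> with \<open>S\<^sub>l = \<Sum>\<^sub>n \<lambda>\<^sub>l(n) u\<^sub>n u\<^sub>n\<^sup>T\<close>. The square matrix \<open>U\<close> has its columns
  \<open>u\<^sub>n\<close> indexed by the \<open>N\<close>-element type \<open>'v\<close> itself instead of by \<open>1, \<dots>, N\<close>; the vector
  \<open>lam n\<close> has components \<open>\<lambda>\<^sub>l(n)\<close>.\<close>

definition joint_diagonalization ::
    "('d::finite \<Rightarrow> real^'v^'v) \<Rightarrow> real^'v^'v \<Rightarrow> ('v \<Rightarrow> real^'d) \<Rightarrow> bool" where
  "joint_diagonalization S U lam \<longleftrightarrow>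
     orthogonal_matrix U \<and>
     (\<forall>l. S l = (\<Sum>n\<in>UNIV. (lam n $ l) *\<^sub>R outer (column n U)))"

definition spectral_projection ::
    "real^'v^'v \<Rightarrow> ('v \<Rightarrow> real^'d) \<Rightarrow> (nat \<Rightarrow> real^'d) \<Rightarrow> nat \<Rightarrow> real^'v^'v" where
  "spectral_projection U lam gam m = (\<Sum>n | lam n = gam m. outer (column n U))"

definition gft ::
    "real^'v^'v \<Rightarrow> ('v \<Rightarrow> real^'d) \<Rightarrow> (nat \<Rightarrow> real^'d) \<Rightarrow> real^'v \<Rightarrow> nat \<Rightarrow> real^'v" where
  "gft U lam gam x m = spectral_projection U lam gam m *v x"

definition spectral_space ::
    "real^'v^'v \<Rightarrow> ('v \<Rightarrow> real^'d) \<Rightarrow> (nat \<Rightarrow> real^'d) \<Rightarrow> nat \<Rightarrow> (real^'v) set" where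
  "spectral_space U lam gam m = range ((*v) (spectral_projection U lam gam m))"

definition concentration ::
    "real^'v^'v \<Rightarrow> ('v \<Rightarrow> real^'d) \<Rightarrow> (nat \<Rightarrow> real^'d) \<Rightarrow> 'v set \<Rightarrow> nat set \<Rightarrow> real" where
  "concentration U lam gam Y \<Omega> =
     sqrt (\<Sum>m\<in>\<Omega>. \<Sum>v\<in>Y. (norm (gft U lam gam (axis v 1) m))\<^sup>2)"

text \<open>Internal sum of subspaces. Applied to the spectral spaces of distinct joint eigenvalues it
  is direct, these spaces being mutually orthogonal.\<close>

definition subspace_sum :: "'i set \<Rightarrow> ('i \<Rightarrow> (real^'v) set) \<Rightarrow> (real^'v) set" where
  "subspace_sum I W = {(\<Sum>i\<in>I. w i) | w. \<forall>i\<in>I. w i \<in> W i}"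

definition spectral_dim ::
    "real^'v^'v \<Rightarrow> ('v \<Rightarrow> real^'d) \<Rightarrow> (nat \<Rightarrow> real^'d) \<Rightarrow> nat set \<Rightarrow> nat" where
  "spectral_dim U lam gam \<Omega> = dim (subspace_sum \<Omega> (spectral_space U lam gam))"

end

theory Submission
  imports Defs
begin

text \<open>Let \<open>K\<close> index the eigenvectors in \<open>\<Oplus>\<^sub>m\<^sub>\<in>\<^sub>\<Omega> W\<^sub>m\<close> and let \<open>P\<close> be the orthogonal projection onto that
  space. Then \<open>\<parallel>x\<parallel> \<le> \<parallel>x - P x\<parallel> + \<parallel>P x\<parallel>\<close>, and expanding \<open>P x = \<Sum>\<^sub>v x(v) P \<delta>\<^sub>v\<close> and applying
  Cauchy--Schwarz separately on \<open>Y\<close> and its complement bounds \<open>\<parallel>P x\<parallel>\<close> by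
  \<open>\<alpha> \<parallel>x\<parallel> + (dim \<Omega> - \<alpha>\<^sup>2)\<^sup>1\<^sup>/\<^sup>2 \<parallel>x restricted to the complement of Y\<parallel>\<close>, because
  \<open>\<Sum>\<^sub>v \<parallel>P \<delta>\<^sub>v\<parallel>\<^sup>2 = trace P = dim \<Omega>\<close>. The term \<open>\<alpha> \<parallel>x\<parallel>\<close> is absorbed on the left.\<close>

lemma inner_columns_orthogonal_matrix:
  fixes U :: "real^'n^'n"
  assumes "orthogonal_matrix U"
  shows "column m U \<bullet> column n U = (if m = n then 1 else 0)"
  using assms unfolding orthogonal_matrix_orthonormal_columns orthogonal_def norm_eq_1
  by auto

lemma norm_sum_columns_squared:
  fixes U :: "real^'n^'n"
  assumes "orthogonal_matrix U"
  shows "(norm (\<Sum>n\<in>K. c n *\<^sub>R column n U))\<^sup>2 = (\<Sum>n\<in>K. (c n)\<^sup>2)"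
  unfolding power2_norm_eq_inner
  by (simp add: inner_sum_left inner_sum_right inner_columns_orthogonal_matrix[OF assms]
      if_distrib sum.delta power2_eq_square cong: if_cong)

text \<open>Parseval: \<open>transpose U\<close> is an isometry, and its output lists the
  coefficients of \<open>x\<close> in the basis of columns.\<close>

lemma norm_squared_eq_sum_inner_columns:
  fixes U :: "real^'n^'n"
  assumes "orthogonal_matrix U"
  shows "(norm x)\<^sup>2 = (\<Sum>n\<in>UNIV. (column n U \<bullet> x)\<^sup>2)"
proof -
  have "norm x = norm (transpose U *v x)"
    using assms
    by (metis orthogonal_matrix_transpose orthogonal_transformation_matrix
        orthogonal_transformation_norm matrix_of_matrix_vector_mul matrix_vector_mul_linear)
  also have "transpose U *v x = (\<chi> n. column n U \<bullet> x)"
    by (simp add: vec_eq_iff matrix_vector_mult_def transpose_def column_def inner_vec_def)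
  finally show ?thesis
    by (simp add: norm_vec_def L2_set_def sum_nonneg)
qed

lemma outer_mult_vector: "outer u *v x = (u \<bullet> x) *\<^sub>R u"
  by (simp add: vec_eq_iff outer_def matrix_vector_mult_def inner_vec_def sum_distrib_left
      sum_distrib_right mult_ac)

lemma gft_eq_sum_columns:
  "gft U lam gam x m = (\<Sum>n | lam n = gam m. (column n U \<bullet> x) *\<^sub>R column n U)"
proof -
  have "(\<Sum>n\<in>A. outer (column n U)) *v x = (\<Sum>n\<in>A. outer (column n U) *v x)" for A
    by (induction A rule: infinite_finite_induct) (auto simp: matrix_vector_mult_add_rdistrib)
  then show ?thesis
    by (simp add: gft_def spectral_projection_def outer_mult_vector)
qed

text \<open>Distinct joint eigenvalues have disjoint sets of eigenvector indices, so Pythagoras in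
  each spectral space merges into one sum over columns. Applied below to \<open>\<Omega>\<close>
  with delta signals and to its complement with \<open>x\<close>.\<close>

lemma sum_norm_gft_squared:
  assumes U: "orthogonal_matrix U" and inj: "inj_on gam A" and A: "finite A"
  shows "(\<Sum>m\<in>A. (norm (gft U lam gam x m))\<^sup>2)
    = (\<Sum>n | lam n \<in> gam ` A. (column n U \<bullet> x)\<^sup>2)"
proof -
  have "(\<Sum>m\<in>A. (norm (gft U lam gam x m))\<^sup>2)
      = (\<Sum>m\<in>A. \<Sum>n | lam n = gam m. (column n U \<bullet> x)\<^sup>2)"
    by (simp add: gft_eq_sum_columns norm_sum_columns_squared[OF U])
  also have "\<dots> = (\<Sum>n\<in>(\<Union>m\<in>A. {n. lam n = gam m}). (column n U \<bullet> x)\<^sup>2)"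
    using inj A by (intro sum.UNION_disjoint[symmetric]) (auto dest: inj_onD)
  also have "(\<Union>m\<in>A. {n. lam n = gam m}) = {n. lam n \<in> gam ` A}"
    by auto
  finally show ?thesis .
qed

text \<open>The selected columns are orthonormal vectors of the sum space, hence independent there.
  The main estimate uses the dimension only as an upper bound for this count.\<close>

lemma card_le_spectral_dim:
  assumes U: "orthogonal_matrix U" and A: "finite A"
  shows "card {n. lam n \<in> gam ` A} \<le> spectral_dim U lam gam A"
proof -
  let ?K = "{n. lam n \<in> gam ` A}"
  have col: "column n U \<in> subspace_sum A (spectral_space U lam gam)" if n: "n \<in> ?K" for n
  proof -
    obtain m where m: "m \<in> A" "lam n = gam m"
      using n by auto
    have "gft U lam gam (column n U) m = column n U"
      using m by (simp add: gft_eq_sum_columns inner_columns_orthogonal_matrix[OF U]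
          if_distrib[of "\<lambda>c. c *\<^sub>R _"] sum.delta cong: if_cong)
    then have "column n U \<in> spectral_space U lam gam m"
      unfolding spectral_space_def gft_def by (metis rangeI)
    moreover have "0 \<in> spectral_space U lam gam i" for i
      unfolding spectral_space_def by (metis matrix_vector_mult_0_right rangeI)
    \<comment> \<open>Membership in the sum is witnessed by the family that is the column at
      \<open>m\<close> and zero elsewhere.\<close>
    ultimately have "\<forall>i\<in>A. (if i = m then column n U else 0) \<in> spectral_space U lam gam i"
      by simp
    moreover have "column n U = (\<Sum>i\<in>A. if i = m then column n U else 0)"
      using m A by (simp add: sum.delta)
    ultimately show ?thesis
      unfolding subspace_sum_def by blast
  qed
  have inj: "inj (\<lambda>n. column n U)"
    by (rule injI) (metis inner_columns_orthogonal_matrix[OF U] zero_neq_one)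
  have "pairwise orthogonal ((\<lambda>n. column n U) ` ?K)"
    by (auto simp: pairwise_def orthogonal_def inner_columns_orthogonal_matrix[OF U])
  moreover have "0 \<notin> (\<lambda>n. column n U) ` ?K"
    by (metis (no_types, lifting) imageE inner_columns_orthogonal_matrix[OF U] inner_zero_left
        zero_neq_one)
  ultimately have "independent ((\<lambda>n. column n U) ` ?K)"
    by (rule pairwise_orthogonal_independent)
  then have "card ((\<lambda>n. column n U) ` ?K) \<le> spectral_dim U lam gam A"
    unfolding spectral_dim_def using col by (intro independent_card_le_dim) auto
  then show ?thesis
    using inj by (simp add: card_image inj_on_subset)
qed

text \<open>For orthonormal \<open>u n\<close> this is the triangle inequality for P x = sum of x(v)
  P delta_v, written in coordinates. The proof is by duality: the coefficient vector is paired with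
  itself, and one factor of its norm is cancelled.\<close>

lemma L2_set_inner_le:
  fixes u :: "'k \<Rightarrow> real^'v"
  shows "L2_set (\<lambda>n. u n \<bullet> x) K \<le> (\<Sum>v\<in>UNIV. \<bar>x $ v\<bar> * L2_set (\<lambda>n. u n $ v) K)"
proof -
  let ?a = "L2_set (\<lambda>n. u n \<bullet> x) K" and ?c = "\<lambda>v. L2_set (\<lambda>n. u n $ v) K"
  have "?a * ?a = (\<Sum>n\<in>K. (u n \<bullet> x) * (u n \<bullet> x))"
    by (simp add: L2_set_def sum_nonneg flip: power2_eq_square)
  also have "\<dots> = (\<Sum>n\<in>K. \<Sum>v\<in>UNIV. x $ v * ((u n \<bullet> x) * u n $ v))"
  proof (rule sum.cong[OF refl])
    fix n
    have "(u n \<bullet> x) * (u n \<bullet> x) = (u n \<bullet> x) * (\<Sum>v\<in>UNIV. u n $ v * x $ v)"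
      by (simp add: inner_vec_def)
    then show "(u n \<bullet> x) * (u n \<bullet> x) = (\<Sum>v\<in>UNIV. x $ v * ((u n \<bullet> x) * u n $ v))"
      by (simp add: sum_distrib_left mult_ac)
  qed
  also have "\<dots> = (\<Sum>v\<in>UNIV. x $ v * (\<Sum>n\<in>K. (u n \<bullet> x) * u n $ v))"
    by (subst sum.swap) (simp add: sum_distrib_left)
  \<comment> \<open>Cauchy-Schwarz over \<open>K\<close> for each vertex leaves a common factor
    \<open>?a\<close>.\<close>
  also have "\<dots> \<le> (\<Sum>v\<in>UNIV. \<bar>x $ v\<bar> * (?a * ?c v))"
  proof (rule sum_mono)
    fix v
    have "\<bar>\<Sum>n\<in>K. (u n \<bullet> x) * u n $ v\<bar> \<le> (\<Sum>n\<in>K. \<bar>u n \<bullet> x\<bar> * \<bar>u n $ v\<bar>)"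
      using sum_abs[of "\<lambda>n. (u n \<bullet> x) * u n $ v" K] by (simp add: abs_mult)
    also have "\<dots> \<le> ?a * ?c v"
      by (rule L2_set_mult_ineq)
    finally have "\<bar>x $ v * (\<Sum>n\<in>K. (u n \<bullet> x) * u n $ v)\<bar> \<le> \<bar>x $ v\<bar> * (?a * ?c v)"
      by (simp add: abs_mult mult_left_mono)
    then show "x $ v * (\<Sum>n\<in>K. (u n \<bullet> x) * u n $ v) \<le> \<bar>x $ v\<bar> * (?a * ?c v)"
      by linarith
  qed
  also have "\<dots> = ?a * (\<Sum>v\<in>UNIV. \<bar>x $ v\<bar> * ?c v)"
    by (simp add: sum_distrib_left mult_ac)
  finally have "?a * ?a \<le> ?a * (\<Sum>v\<in>UNIV. \<bar>x $ v\<bar> * ?c v)" .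
  moreover have "0 \<le> (\<Sum>v\<in>UNIV. \<bar>x $ v\<bar> * ?c v)"
    by (intro sum_nonneg mult_nonneg_nonneg) (auto simp: L2_set_nonneg)
  ultimately show ?thesis
    by (cases "?a = 0") (auto simp: L2_set_nonneg order_less_le)
qed

theorem theoremB1:
  fixes E :: "('v::finite \<times> 'v) set"
    and S :: "'d::finite \<Rightarrow> real^'v^'v"
    and U :: "real^'v^'v"
    and lam :: "'v \<Rightarrow> real^'d"
    and gam :: "nat \<Rightarrow> real^'d"
    and M :: nat
    and Y :: "'v set"
    and \<Omega> :: "nat set"
    and x :: "real^'v"
  assumes "CARD('v) \<ge> 2"
    and "simple_graph E"
    and "\<And>l. graph_shift E (S l)"
    and "\<And>l. transpose (S l) = S l"
    and "\<And>k l. S k ** S l = S l ** S k"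
    and "joint_diagonalization S U lam"
    and "bij_betw gam {1..M} (range lam)"
    and "Y \<noteq> {}"
    and "\<Omega> \<subseteq> {1..M}"
    and "\<Omega> \<noteq> {}"
    and "concentration U lam gam Y \<Omega> < 1"
  shows "norm x \<le>
      inverse (1 - concentration U lam gam Y \<Omega>)
        * sqrt (\<Sum>m\<in>{1..M} - \<Omega>. (norm (gft U lam gam x m))\<^sup>2)
      + sqrt (real (spectral_dim U lam gam \<Omega>) - (concentration U lam gam Y \<Omega>)\<^sup>2)
          / (1 - concentration U lam gam Y \<Omega>)
        * sqrt (\<Sum>v\<in>- Y. \<bar>x $ v\<bar>\<^sup>2)"
proof -
  define a where "a = concentration U lam gam Y \<Omega>"
  define K where "K = {n. lam n \<in> gam ` \<Omega>}"
  \<comment> \<open>\<open>c v\<close> is the norm of P delta_v.\<close>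
  define c where "c v = L2_set (\<lambda>n. column n U $ v) K" for v
  have U: "orthogonal_matrix U"
    using assms(6) by (simp add: joint_diagonalization_def)
  have inj: "inj_on gam {1..M}" and img: "gam ` {1..M} = range lam"
    using assms(7) by (auto simp: bij_betw_def)
  have fin: "finite \<Omega>"
    using assms(9) finite_subset by blast
  have inj\<Omega>: "inj_on gam \<Omega>"
    using inj assms(9) by (rule inj_on_subset)
  have c2: "(c v)\<^sup>2 = (\<Sum>n\<in>K. (column n U $ v)\<^sup>2)" for v
    by (simp add: c_def L2_set_def sum_nonneg)
  \<comment> \<open>After swapping the sums, the inner sum over \<open>\<Omega>\<close> is the
    squared norm of the projected delta signal.\<close>
  have a_L2: "a = L2_set c Y"
    unfolding a_def concentration_def
    by (subst sum.swap)
      (simp add: sum_norm_gft_squared[OF U inj\<Omega> fin] L2_set_def c2 inner_axis flip: K_def)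
  have a2: "a\<^sup>2 = (\<Sum>v\<in>Y. (c v)\<^sup>2)"
    by (simp add: a_L2 L2_set_def sum_nonneg)
  have a0: "0 \<le> a" and a1: "a < 1"
    using assms(11) by (auto simp: a_L2 L2_set_nonneg simp flip: a_def)
  \<comment> \<open>The trace of P, evaluated column by column: each column is a unit
    vector.\<close>
  have "(\<Sum>v\<in>UNIV. (c v)\<^sup>2) = (\<Sum>n\<in>K. \<Sum>v\<in>UNIV. (column n U $ v)\<^sup>2)"
    unfolding c2 by (rule sum.swap)
  also have "\<dots> = (\<Sum>n\<in>K. column n U \<bullet> column n U)"
    by (simp add: inner_vec_def power2_eq_square)
  also have "\<dots> = card K"
    by (simp add: inner_columns_orthogonal_matrix[OF U])
  finally have "(\<Sum>v\<in>Y. (c v)\<^sup>2) + (\<Sum>v\<in>-Y. (c v)\<^sup>2) = card K"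
    by (metis Compl_disjoint Compl_partition finite sum.union_disjoint)
  then have "(\<Sum>v\<in>-Y. (c v)\<^sup>2) \<le> real (spectral_dim U lam gam \<Omega>) - a\<^sup>2"
    using card_le_spectral_dim[OF U fin, of lam gam] by (simp add: a2 K_def)
  then have cY: "L2_set c (-Y) \<le> sqrt (real (spectral_dim U lam gam \<Omega>) - a\<^sup>2)"
    by (simp add: L2_set_def)
  \<comment> \<open>\<open>sqrt\<close> is negative at negative arguments, so its sign must be known
    before the products are compared.\<close>
  then have rad: "0 \<le> sqrt (real (spectral_dim U lam gam \<Omega>) - a\<^sup>2)"
    by (rule order_trans[OF L2_set_nonneg])
  have "L2_set (\<lambda>n. column n U \<bullet> x) K \<le> (\<Sum>v\<in>UNIV. \<bar>x $ v\<bar> * c v)"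
    unfolding c_def by (rule L2_set_inner_le)
  also have "\<dots> = (\<Sum>v\<in>Y. \<bar>c v\<bar> * \<bar>x $ v\<bar>) + (\<Sum>v\<in>-Y. \<bar>c v\<bar> * \<bar>x $ v\<bar>)"
    by (subst sum.union_disjoint[symmetric]) (auto simp: c_def L2_set_nonneg mult.commute)
  also have "\<dots> \<le> L2_set c Y * L2_set (($) x) Y + L2_set c (-Y) * L2_set (($) x) (-Y)"
    by (intro add_mono L2_set_mult_ineq)
  also have "\<dots> \<le> a * norm x
      + sqrt (real (spectral_dim U lam gam \<Omega>) - a\<^sup>2) * L2_set (($) x) (-Y)"
  proof (intro add_mono mult_mono)
    show "L2_set (($) x) Y \<le> norm x"
      by (auto simp: norm_vec_def L2_set_def intro!: sum_mono2)
  qed (use cY rad a0 in \<open>auto simp: a_L2 L2_set_nonneg\<close>)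
  finally have low: "L2_set (\<lambda>n. column n U \<bullet> x) K \<le> a * norm x
      + sqrt (real (spectral_dim U lam gam \<Omega>) - a\<^sup>2) * sqrt (\<Sum>v\<in>-Y. \<bar>x $ v\<bar>\<^sup>2)"
    by (simp add: L2_set_def)
  \<comment> \<open>Injectivity of \<open>gam\<close> makes the frequencies outside
    \<open>\<Omega>\<close> correspond exactly to the eigenvector indices in
    \<open>-K\<close>.\<close>
  have "gam ` ({1..M} - \<Omega>) = range lam - gam ` \<Omega>"
    using inj_on_image_set_diff[OF inj, of "{1..M}" \<Omega>] assms(9) img by simp
  then have "{n. lam n \<in> gam ` ({1..M} - \<Omega>)} = -K"
    by (auto simp: K_def)
  then have high: "(\<Sum>m\<in>{1..M} - \<Omega>. (norm (gft U lam gam x m))\<^sup>2)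
      = (\<Sum>n\<in>-K. (column n U \<bullet> x)\<^sup>2)"
    by (subst sum_norm_gft_squared[OF U]) (auto intro: inj_on_subset[OF inj])
  have "(norm x)\<^sup>2 = (\<Sum>n\<in>-K. (column n U \<bullet> x)\<^sup>2) + (\<Sum>n\<in>K. (column n U \<bullet> x)\<^sup>2)"
    unfolding norm_squared_eq_sum_inner_columns[OF U]
    by (subst sum.union_disjoint[symmetric]) auto
  then have "norm x = sqrt ((\<Sum>n\<in>-K. (column n U \<bullet> x)\<^sup>2) + (\<Sum>n\<in>K. (column n U \<bullet> x)\<^sup>2))"
    by (metis norm_ge_zero real_sqrt_unique)
  \<comment> \<open>Subadditivity of the square root gives the triangle inequality between the two
    spectral parts of \<open>x\<close>.\<close>
  also have "\<dots> \<le> sqrt (\<Sum>n\<in>-K. (column n U \<bullet> x)\<^sup>2) + L2_set (\<lambda>n. column n U \<bullet> x) K"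
    unfolding L2_set_def by (intro sqrt_add_le_add_sqrt sum_nonneg) auto
  finally have "(1 - a) * norm x \<le> sqrt (\<Sum>m\<in>{1..M} - \<Omega>. (norm (gft U lam gam x m))\<^sup>2)
      + sqrt (real (spectral_dim U lam gam \<Omega>) - a\<^sup>2) * sqrt (\<Sum>v\<in>-Y. \<bar>x $ v\<bar>\<^sup>2)"
    unfolding high using low by (simp add: algebra_simps)
  then have "norm x \<le> (sqrt (\<Sum>m\<in>{1..M} - \<Omega>. (norm (gft U lam gam x m))\<^sup>2)
      + sqrt (real (spectral_dim U lam gam \<Omega>) - a\<^sup>2) * sqrt (\<Sum>v\<in>-Y. \<bar>x $ v\<bar>\<^sup>2)) / (1 - a)"
    using a1 by (subst pos_le_divide_eq) (auto simp: mult.commute)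
  then show ?thesis
    unfolding a_def[symmetric] by (simp add: distrib_left divide_inverse mult_ac)
qed

end
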